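(* Let $\mathbb{K}$ be a field, let $d,n\in\mathbb{N}$, let $\mathbf{q}=(q_{i_1,\dots,i_d})_{i_1,\dots,i_d\in\{1,\dots,n\}}$ be a tensor with entries in $\mathbb{K}^\times$, and let $\ell\ne j$ be in $\{1,\dots,n\}$. With $\tilde R_m=(1-\chi_{\mathbf q}(v_m))(1-\chi_{\mathbf q}(w_m))$ and $r_m,z_m\in\mathbb{K}^\times$ as defined in the context (for this $\mathbf q,\ell,j$), one has $$\tilde R_0=(1-r_0)(1-z_0),$$ and for all $m\in\mathbb{N}$ with $m\ge 1$ $$\tilde R_m=r_m\,\tilde R_{m-1}+(1-r_m)(1-z_m).$$
   Context: Let $\alpha_1,\dots,\alpha_n$ be the standard basis of $\mathbb{Z}^n$ and $W=(\mathbb{Z}^n)^{\otimes d}$ (tensor power over $\mathbb{Z}$), a free abelian group with basis the elements $\alpha_{i_1}\otimes\cdots\otimes\alpha_{i_d}$. Let $\chi_{\mathbf q}:(W,+)\to\mathbb{K}^\times$ be the group homomorphism with $\chi_{\mathbf q}(\alpha_{i_1}\otimes\cdots\otimes\alpha_{i_d})=q_{i_1,\dots,i_d}$. For $m\in\mathbb{N}_0$ put $$u_m=((m+1)\alpha_\ell+\alpha_j)^{\otimes d}-(m\alpha_\ell+\alpha_j)^{\otimes d}\in W.$$ Let $\sigma_\ell=\sigma_\ell^{(m)}$ be the reflection with $\sigma_\ell(\alpha_\ell)=-\alpha_\ell$ and $\sigma_\ell(\alpha_j)=\alpha_j+m\alpha_\ell$ (only its action on the span of $\alpha_\ell,\alpha_j$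 matters). Put $$v_m=\tfrac12\big(\sigma_\ell^{\otimes d}(u_m)+u_m\big),\qquad w_m=-\tfrac12\big(\sigma_\ell^{\otimes d}(u_m)-u_m\big);$$ both lie in $W$ and $u_m=v_m+w_m$. For $k\in\{0,\dots,d\}$ let $$q_k=\prod_{\substack{i_1,\dots,i_d\in\{\ell,j\}\\ |\{\nu\,:\,i_\nu=j\}|=k}}q_{i_1,\dots,i_d}.$$ For $m\in\mathbb{N}_0$ and $k\in\{0,\dots,d\}$, with the convention $0^0=1$, let $$e_{m,k}=\sum_{\substack{0\le\nu\le k-2\\ \nu\equiv k\ (\mathrm{mod}\ 2)}}\binom{k}{\nu}m^\nu,\qquad f_{m,k}=\sum_{\substack{0\le\nu\le k-1\\ \nu\equiv k+1\ (\mathrm{mod}\ 2)}}\binom{k}{\nu}m^\nu,$$ $$r_m=\prod_{i=0}^{d-2}q_i^{e_{m,d-i}},\qquad z_m=\prod_{i=0}^{d-1}q_i^{f_{m,d-i}},$$ where empty sums are $0$ and empty products are $1$. *)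

theory Defs
  imports "HOL-Analysis.Finite_Cartesian_Product"
begin

text \<open>
  The index set \<open>{1..n}\<close> is a finite type \<open>'n\<close> and the set \<open>{1..d}\<close> of tensor positions a finite
  type \<open>'d\<close>, so that \<open>n = CARD('n) \<ge> 1\<close> and \<open>d = CARD('d) \<ge> 1\<close>. A multi-index is an element of
  \<open>'n ^ 'd\<close>, and an element of the tensor power \<open>W\<close> is given by its coordinates with respect to the
  basis of all \<open>\<alpha>\<^sub>i\<^sub>1 \<otimes> \<dots> \<otimes> \<alpha>\<^sub>i\<^sub>d\<close>.
\<close>

type_synonym ('n, 'd) tensor_power = "int ^ ('n ^ 'd)"

definition alpha :: "'n::finite \<Rightarrow> int ^ 'n" where
  "alpha i = axis i 1"

definition pure_tensor :: "('d::finite \<Rightarrow> int ^ 'n::finite) \<Rightarrow> ('n, 'd) tensor_power" where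
  "pure_tensor x = (\<chi> i. \<Prod>\<nu>\<in>UNIV. x \<nu> $ (i $ \<nu>))"

definition tpower :: "int ^ 'n::finite \<Rightarrow> ('n, 'd::finite) tensor_power" where
  "tpower x = pure_tensor (\<lambda>_. x)"

text \<open>The map \<open>f\<^sup>\<otimes>\<^sup>d\<close>, i.e. the linear extension of
  \<open>\<alpha>\<^sub>i\<^sub>1 \<otimes> \<dots> \<otimes> \<alpha>\<^sub>i\<^sub>d \<mapsto> f \<alpha>\<^sub>i\<^sub>1 \<otimes> \<dots> \<otimes> f \<alpha>\<^sub>i\<^sub>d\<close>.\<close>

definition tpower_map ::
  "(int ^ 'n::finite \<Rightarrow> int ^ 'n) \<Rightarrow> ('n, 'd::finite) tensor_power \<Rightarrow> ('n, 'd) tensor_power" where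
  "tpower_map f t = (\<Sum>i\<in>UNIV. t $ i *s pure_tensor (\<lambda>\<nu>. f (alpha (i $ \<nu>))))"

text \<open>The homomorphism from \<open>(W, +)\<close> to the units of \<open>'k\<close> that maps each basis element to the
  corresponding entry of \<open>q\<close>; see \<open>char_hom_add\<close> and \<open>char_hom_basis\<close> below.\<close>

definition char_hom ::
  "('n::finite ^ 'd::finite \<Rightarrow> 'k::field) \<Rightarrow> ('n, 'd) tensor_power \<Rightarrow> 'k" where
  "char_hom q w = (\<Prod>i\<in>UNIV. q i powi (w $ i))"

text \<open>A reflection with root \<open>\<alpha>\<^sub>l\<close>: it negates \<open>\<alpha>\<^sub>l\<close> and induces the identity modulo \<open>\<int>\<alpha>\<^sub>l\<close>.\<close>

definition is_reflection :: "'n::finite \<Rightarrow> (int ^ 'n \<Rightarrow> int ^ 'n) \<Rightarrow> bool" where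
  "is_reflection l s \<longleftrightarrow> Modules.additive s \<and> s (alpha l) = - alpha l \<and>
     (\<forall>i. \<exists>c. s (alpha i) = alpha i + c *s alpha l)"

definition uu :: "'n::finite \<Rightarrow> 'n \<Rightarrow> nat \<Rightarrow> ('n, 'd::finite) tensor_power" where
  "uu l j m = tpower ((int m + 1) *s alpha l + alpha j) - tpower (int m *s alpha l + alpha j)"

text \<open>Halving in \<open>W\<close>; it is only applied to tensors with even coordinates, see \<open>vv_double\<close> and
  \<open>ww_double\<close> below.\<close>

definition half :: "int ^ 'i \<Rightarrow> int ^ 'i" where
  "half x = (\<chi> i. x $ i div 2)"

definition vv ::
  "(int ^ 'n::finite \<Rightarrow> int ^ 'n) \<Rightarrow> 'n \<Rightarrow> 'n \<Rightarrow> nat \<Rightarrow> ('n, 'd::finite) tensor_power" where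
  "vv s l j m = half (tpower_map s (uu l j m) + uu l j m)"

definition ww ::
  "(int ^ 'n::finite \<Rightarrow> int ^ 'n) \<Rightarrow> 'n \<Rightarrow> 'n \<Rightarrow> nat \<Rightarrow> ('n, 'd::finite) tensor_power" where
  "ww s l j m = - half (tpower_map s (uu l j m) - uu l j m)"

definition Rtilde ::
  "('n::finite ^ 'd::finite \<Rightarrow> 'k::field) \<Rightarrow> (nat \<Rightarrow> int ^ 'n \<Rightarrow> int ^ 'n) \<Rightarrow> 'n \<Rightarrow> 'n \<Rightarrow> nat \<Rightarrow> 'k" where
  "Rtilde q \<sigma> l j m =
     (1 - char_hom q (vv (\<sigma> m) l j m)) * (1 - char_hom q (ww (\<sigma> m) l j m))"

definition qprod :: "('n::finite ^ 'd::finite \<Rightarrow> 'k::field) \<Rightarrow> 'n \<Rightarrow> 'n \<Rightarrow> nat \<Rightarrow> 'k" where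
  "qprod q l j k =
     (\<Prod>i | (\<forall>\<nu>. i $ \<nu> \<in> {l, j}) \<and> card {\<nu>. i $ \<nu> = j} = k. q i)"

text \<open>The bounds \<open>\<nu> \<le> k - 2\<close>, \<open>\<nu> \<le> k - 1\<close> and \<open>i \<le> d - 2\<close> are written additively because
  subtraction on \<open>nat\<close> is truncated.\<close>

definition ee :: "nat \<Rightarrow> nat \<Rightarrow> nat" where
  "ee m k = (\<Sum>\<nu> | \<nu> + 2 \<le> k \<and> \<nu> mod 2 = k mod 2. (k choose \<nu>) * m ^ \<nu>)"

definition ff :: "nat \<Rightarrow> nat \<Rightarrow> nat" where
  "ff m k = (\<Sum>\<nu> | \<nu> + 1 \<le> k \<and> \<nu> mod 2 = (k + 1) mod 2. (k choose \<nu>) * m ^ \<nu>)"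

definition rr :: "('n::finite ^ 'd::finite \<Rightarrow> 'k::field) \<Rightarrow> 'n \<Rightarrow> 'n \<Rightarrow> nat \<Rightarrow> 'k" where
  "rr q l j m = (\<Prod>i | i + 2 \<le> CARD('d). qprod q l j i ^ ee m (CARD('d) - i))"

definition zz :: "('n::finite ^ 'd::finite \<Rightarrow> 'k::field) \<Rightarrow> 'n \<Rightarrow> 'n \<Rightarrow> nat \<Rightarrow> 'k" where
  "zz q l j m = (\<Prod>i | i + 1 \<le> CARD('d). qprod q l j i ^ ff m (CARD('d) - i))"

lemma char_hom_add:
  assumes "\<And>i. q i \<noteq> 0"
  shows "char_hom q (x + y) = char_hom q x * char_hom q y"
  using assms by (simp add: char_hom_def power_int_add prod.distrib)

lemma pure_tensor_alpha: "pure_tensor (\<lambda>\<nu>. alpha (i $ \<nu>)) = axis i 1"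
  by (auto simp: pure_tensor_def alpha_def axis_def vec_eq_iff intro!: prod.neutral)

lemma char_hom_basis: "char_hom q (pure_tensor (\<lambda>\<nu>. alpha (i $ \<nu>))) = q i"
proof -
  have "char_hom q (axis i 1) = (\<Prod>k\<in>UNIV. if k = i then q i else 1)"
    unfolding char_hom_def by (rule prod.cong) (auto simp: axis_def)
  then show ?thesis by (simp add: pure_tensor_alpha)
qed

lemma additive_smult:
  fixes f :: "int ^ 'n \<Rightarrow> int ^ 'n"
  assumes "Modules.additive f"
  shows "f (c *s x) = c *s f x"
proof -
  interpret Modules.additive f by fact
  have nat_mult: "f (int m *s x) = int m *s f x" for m
    by (induction m) (simp_all add: zero add vector_sadd_rdistrib)
  show ?thesis
  proof (cases c rule: int_cases2)
    case (nonpos m)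
    have "- int m *s y = - (int m *s y)" for y :: "int ^ 'n" by (simp add: vec_eq_iff)
    then show ?thesis using minus[of "int m *s x"] by (simp add: nat_mult nonpos)
  qed (simp add: nat_mult)
qed

lemma additive_coords:
  fixes f :: "int ^ 'n::finite \<Rightarrow> int ^ 'n"
  assumes "Modules.additive f"
  shows "f x = (\<Sum>i\<in>UNIV. x $ i *s f (alpha i))"
proof -
  interpret Modules.additive f by fact
  have "x = (\<Sum>i\<in>UNIV. x $ i *s alpha i)"
    by (simp add: alpha_def vec_eq_iff axis_def if_distrib cong: if_cong)
  then have "f x = f (\<Sum>i\<in>UNIV. x $ i *s alpha i)" by simp
  also have "\<dots> = (\<Sum>i\<in>UNIV. x $ i *s f (alpha i))" by (simp add: sum additive_smult[OF assms])
  finally show ?thesis .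
qed

lemma tpower_map_pure_tensor:
  fixes x :: "'d::finite \<Rightarrow> int ^ 'n::finite"
  assumes "Modules.additive f"
  shows "tpower_map f (pure_tensor x) = pure_tensor (\<lambda>\<nu>. f (x \<nu>))"
proof -
  have "tpower_map f (pure_tensor x) $ k = pure_tensor (\<lambda>\<nu>. f (x \<nu>)) $ k" for k
  proof -
    have "pure_tensor (\<lambda>\<nu>. f (x \<nu>)) $ k =
        (\<Prod>\<nu>\<in>UNIV. \<Sum>i\<in>UNIV. x \<nu> $ i * f (alpha i) $ (k $ \<nu>))"
      by (simp add: pure_tensor_def additive_coords[OF assms, of "x _"])
    also have "\<dots> = (\<Sum>g\<in>UNIV. \<Prod>\<nu>\<in>UNIV. x \<nu> $ g \<nu> * f (alpha (g \<nu>)) $ (k $ \<nu>))"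
      by (simp add: prod_sum_PiE PiE_UNIV_domain)
    also have "\<dots> = (\<Sum>i\<in>UNIV. \<Prod>\<nu>\<in>UNIV. x \<nu> $ (i $ \<nu>) * f (alpha (i $ \<nu>)) $ (k $ \<nu>))"
      by (rule sum.reindex_bij_witness[where i = vec_nth and j = vec_lambda])
         (auto simp: vec_lambda_eta)
    finally show ?thesis
      by (simp add: tpower_map_def pure_tensor_def prod.distrib)
  qed
  then show ?thesis by (simp add: vec_eq_iff)
qed

lemma tpower_map_tpower:
  assumes "Modules.additive f"
  shows "tpower_map f (tpower x) = tpower (f x)"
  using assms by (simp add: tpower_def tpower_map_pure_tensor)

lemma tpower_map_diff: "tpower_map f (s - t) = tpower_map f s - tpower_map f t"
  by (simp add: tpower_map_def vector_ssub_ldistrib vec_eq_iff left_diff_distrib sum_subtractf)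

lemma even_sigma_uu:
  fixes s :: "int ^ 'n::finite \<Rightarrow> int ^ 'n" and i :: "'n ^ 'd::finite"
  assumes s: "is_reflection l s" "s (alpha j) = alpha j + int m *s alpha l"
  shows "even ((tpower_map s (uu l j m) + uu l j m) $ i)"
proof -
  have additive: "Modules.additive s" and l: "s (alpha l) = - alpha l"
    using s by (auto simp: is_reflection_def)
  interpret Modules.additive s by (rule additive)
  have mult: "s (c *s alpha l) = - c *s alpha l" for c
    by (simp add: additive_smult[OF additive] l vec_eq_iff)
  have s1: "s ((int m + 1) *s alpha l + alpha j) = alpha j - alpha l"
    by (simp add: s(2) add mult vec_eq_iff algebra_simps)
  have s0: "s (int m *s alpha l + alpha j) = alpha j"
    by (simp add: s(2) add mult vec_eq_iff)
  have cong: "even ((tpower x :: ('n, 'd) tensor_power) $ i) \<longleftrightarrow> even ((tpower y :: ('n, 'd) tensor_power) $ i)"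
    if "\<And>k. even (x $ k) \<longleftrightarrow> even (y $ k)" for x y :: "int ^ 'n"
    using that by (simp add: tpower_def pure_tensor_def even_prod_iff)
  have eq: "tpower_map s (uu l j m) + uu l j m =
      (tpower (alpha j - alpha l) - tpower (alpha j) + tpower ((int m + 1) *s alpha l + alpha j)
       - tpower (int m *s alpha l + alpha j) :: ('n, 'd) tensor_power)"
    unfolding uu_def tpower_map_diff tpower_map_tpower[OF additive] s1 s0 by simp
  show ?thesis
  proof (cases "even m")
    case True
    then show ?thesis
      using cong[of "alpha j - alpha l" "(int m + 1) *s alpha l + alpha j"]
        cong[of "alpha j" "int m *s alpha l + alpha j"]
      unfolding eq by auto
  next
    case False
    then show ?thesis
      using cong[of "alpha j - alpha l" "int m *s alpha l + alpha j"]
        cong[of "alpha j" "(int m + 1) *s alpha l + alpha j"]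
      unfolding eq by auto
  qed
qed

lemma vv_double:
  assumes "is_reflection l s" "s (alpha j) = alpha j + int m *s alpha l"
  shows "2 *s (vv s l j m :: ('n::finite, 'd::finite) tensor_power) = tpower_map s (uu l j m) + uu l j m"
  using even_sigma_uu[OF assms, where 'd = 'd]
  by (simp add: vv_def half_def vec_eq_iff even_two_times_div_two)

lemma ww_double:
  assumes "is_reflection l s" "s (alpha j) = alpha j + int m *s alpha l"
  shows "2 *s (ww s l j m :: ('n::finite, 'd::finite) tensor_power) = - (tpower_map s (uu l j m) - uu l j m)"
  using even_sigma_uu[OF assms, where 'd = 'd]
  by (simp add: ww_def half_def vec_eq_iff even_two_times_div_two)

lemma uu_eq:
  assumes "is_reflection l s" "s (alpha j) = alpha j + int m *s alpha l"
  shows "uu l j m = (vv s l j m + ww s l j m :: ('n::finite, 'd::finite) tensor_power)"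
proof -
  have "2 *s (vv s l j m + ww s l j m) = (2 *s uu l j m :: ('n, 'd) tensor_power)"
    by (simp add: vector_add_ldistrib vv_double[OF assms] ww_double[OF assms] vec_eq_iff)
  then have "2 * (uu l j m $ i) = 2 * ((vv s l j m + ww s l j m :: ('n, 'd) tensor_power) $ i)" for i
    by (metis vector_smult_component)
  then show ?thesis by (simp only: vec_eq_iff mult_cancel_left) simp
qed

lemma reflection_exists:
  assumes "l \<noteq> j"
  shows "\<exists>s. is_reflection l s \<and> s (alpha j) = alpha j + int m *s alpha l"
proof (intro exI[of _ "\<lambda>x. x + (int m * x $ j - 2 * x $ l) *s alpha l"] conjI)
  let ?s = "\<lambda>x. x + (int m * x $ j - 2 * x $ l) *s alpha l"
  have "Modules.additive ?s"
    by unfold_locales (simp add: vec_eq_iff algebra_simps)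
  then show "is_reflection l ?s"
    using assms by (auto simp: is_reflection_def alpha_def axis_def vec_eq_iff)
  show "?s (alpha j) = alpha j + int m *s alpha l"
    using assms by (auto simp: alpha_def axis_def vec_eq_iff)
qed

end

theory Submission
  imports Defs
begin

text \<open>
  All tensors involved are combinations of the powers \<open>(x \<alpha>\<^sub>l + \<alpha>\<^sub>j)\<^sup>\<otimes>\<^sup>d\<close> with \<open>x\<close> an integer. The
  coordinate of such a power at a multi-index with entries in \<open>{l, j}\<close>, exactly \<open>k\<close> of which are \<open>j\<close>,
  is \<open>x ^ (d - k)\<close>, and its other coordinates vanish. A tensor whose coordinates depend only on \<open>k\<close> in
  this way, say through \<open>g k\<close>, has character value \<open>\<Prod>k\<le>d. q\<^sub>k powi g k\<close> (lemma
  \<open>char_hom_layer_tensor\<close>); in particular \<open>r\<^sub>m\<close> and \<open>z\<^sub>m\<close> are the character values of the tensors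
  \<open>E\<^sub>m\<close> and \<open>F\<^sub>m\<close> given by \<open>g k = e\<^sub>m\<^sub>,\<^sub>d\<^sub>-\<^sub>k\<close> and \<open>g k = f\<^sub>m\<^sub>,\<^sub>d\<^sub>-\<^sub>k\<close>.

  As \<open>\<sigma>\<^sub>l\<close> maps \<open>x \<alpha>\<^sub>l + \<alpha>\<^sub>j\<close> to \<open>(m - x) \<alpha>\<^sub>l + \<alpha>\<^sub>j\<close>, the doubled coordinates of \<open>v\<^sub>m\<close> and \<open>w\<^sub>m\<close> are
  \<open>(m+1)\<^sup>a - m\<^sup>a \<plusminus> ((-1)\<^sup>a - 0\<^sup>a)\<close> with \<open>a = d - k\<close>. On the other hand, the binomial theorem gives
  \<open>2 e\<^sub>m\<^sub>,\<^sub>a = (m+1)\<^sup>a + (m-1)\<^sup>a - 2 m\<^sup>a\<close> and \<open>2 f\<^sub>m\<^sub>,\<^sub>a = (m+1)\<^sup>a - (m-1)\<^sup>a\<close>. Comparing coordinates,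
  \<open>v\<^sub>0 = E\<^sub>0\<close>, \<open>w\<^sub>0 = F\<^sub>0\<close>, and for \<open>m \<ge> 1\<close>
  \<open>v\<^sub>m = v\<^sub>m\<^sub>-\<^sub>1 + E\<^sub>m\<close>, \<open>w\<^sub>m = w\<^sub>m\<^sub>-\<^sub>1 + E\<^sub>m\<close>, \<open>v\<^sub>m + w\<^sub>m\<^sub>-\<^sub>1 = F\<^sub>m\<close>.
  With \<open>V\<close> and \<open>W\<close> the character values of \<open>v\<^sub>m\<^sub>-\<^sub>1\<close> and \<open>w\<^sub>m\<^sub>-\<^sub>1\<close>, the recursion thus reduces to the
  identity \<open>(1 - r V) (1 - r W) = r (1 - V) (1 - W) + (1 - r) (1 - z)\<close> for \<open>z = r V W\<close>.
\<close>

lemma binomial_succ_sum: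
  "((x::int) + 1) ^ k = (\<Sum>\<nu><k. int (k choose \<nu>) * x ^ \<nu>) + x ^ k"
  by (simp add: binomial_ring lessThan_Suc_atMost[symmetric])

lemma binomial_pred_sum:
  "((x::int) - 1) ^ k = (\<Sum>\<nu><k. int (k choose \<nu>) * x ^ \<nu> * (-1) ^ (k - \<nu>)) + x ^ k"
  using binomial_ring[of x "-1" k] by (simp add: lessThan_Suc_atMost[symmetric])

lemma double_ee: "2 * int (ee m k) = (int m + 1) ^ k + (int m - 1) ^ k - 2 * int m ^ k"
proof -
  \<comment> \<open>Equal parity and \<open>\<nu> < k\<close> already force \<open>\<nu> \<le> k - 2\<close>.\<close>
  have set: "{\<nu>. \<nu> + 2 \<le> k \<and> \<nu> mod 2 = k mod 2} = {\<nu> \<in> {..<k}. \<nu> mod 2 = k mod 2}"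
    by auto presburger
  have "2 * int (ee m k) =
      (\<Sum>\<nu><k. if \<nu> mod 2 = k mod 2 then 2 * (int (k choose \<nu>) * int m ^ \<nu>) else 0)"
    unfolding ee_def set by (simp add: sum.inter_filter sum_distrib_left del: lessThan_iff)
      (auto intro: sum.cong)
  also have "\<dots> = (\<Sum>\<nu><k. int (k choose \<nu>) * int m ^ \<nu> +
      int (k choose \<nu>) * int m ^ \<nu> * (-1) ^ (k - \<nu>))"
    by (rule sum.cong) (auto simp: minus_one_power_iff even_diff_nat mod2_eq_if split: if_splits)
  finally show ?thesis
    by (simp add: sum.distrib binomial_succ_sum binomial_pred_sum)
qed

lemma double_ff: "2 * int (ff m k) = (int m + 1) ^ k - (int m - 1) ^ k"
proof -
  have set: "{\<nu>. \<nu> + 1 \<le> k \<and> \<nu> mod 2 = (k + 1) mod 2} = {\<nu> \<in> {..<k}. \<nu> mod 2 \<noteq> k mod 2}"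
    by auto presburger+
  have "2 * int (ff m k) =
      (\<Sum>\<nu><k. if \<nu> mod 2 \<noteq> k mod 2 then 2 * (int (k choose \<nu>) * int m ^ \<nu>) else 0)"
    unfolding ff_def set by (simp add: sum.inter_filter sum_distrib_left del: lessThan_iff)
      (auto intro: sum.cong)
  also have "\<dots> = (\<Sum>\<nu><k. int (k choose \<nu>) * int m ^ \<nu> -
      int (k choose \<nu>) * int m ^ \<nu> * (-1) ^ (k - \<nu>))"
    by (rule sum.cong) (auto simp: minus_one_power_iff even_diff_nat mod2_eq_if split: if_splits)
  finally show ?thesis
    by (simp add: sum_subtractf binomial_succ_sum binomial_pred_sum)
qed

text \<open>The tensor supported on the multi-indices with entries in \<open>{l, j}\<close> whose coordinate at a
  multi-index with exactly \<open>k\<close> entries \<open>j\<close> is \<open>g k\<close>.\<close>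

definition layer_tensor ::
  "'n::finite \<Rightarrow> 'n \<Rightarrow> (nat \<Rightarrow> int) \<Rightarrow> ('n, 'd::finite) tensor_power" where
  "layer_tensor l j g =
     (\<chi> i. if \<forall>\<nu>. i $ \<nu> \<in> {l, j} then g (card {\<nu>. i $ \<nu> = j}) else 0)"

lemma char_hom_layer_tensor:
  fixes q :: "'n::finite ^ 'd::finite \<Rightarrow> 'k::field"
  shows "char_hom q (layer_tensor l j g) = (\<Prod>k\<le>CARD('d). qprod q l j k powi g k)"
proof -
  let ?A = "{i :: 'n ^ 'd. \<forall>\<nu>. i $ \<nu> \<in> {l, j}}"
  let ?c = "\<lambda>i :: 'n ^ 'd. card {\<nu>. i $ \<nu> = j}"
  have powi_prod: "(\<Prod>i\<in>S. q i powi z) = (\<Prod>i\<in>S. q i) powi z" for S z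
    by (induction S rule: infinite_finite_induct) (auto simp: power_int_mult_distrib)
  have "char_hom q (layer_tensor l j g) = (\<Prod>i\<in>UNIV. if i \<in> ?A then q i powi g (?c i) else 1)"
    unfolding char_hom_def layer_tensor_def by (rule prod.cong) auto
  also have "\<dots> = (\<Prod>i\<in>?A. q i powi g (?c i))"
    by (simp add: prod.If_cases)
  also have "\<dots> = (\<Prod>k\<le>CARD('d). \<Prod>i\<in>{i \<in> ?A. ?c i = k}. q i powi g (?c i))"
    by (rule prod.group[symmetric]) (auto intro: card_mono)
  also have "\<dots> = (\<Prod>k\<le>CARD('d). qprod q l j k powi g k)"
    unfolding qprod_def powi_prod[symmetric] by (intro prod.cong) auto
  finally show ?thesis .
qed

lemma rr_eq_char_hom:
  fixes q :: "'n::finite ^ 'd::finite \<Rightarrow> 'k::field"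
  shows "rr q l j m = char_hom q (layer_tensor l j (\<lambda>k. int (ee m (CARD('d) - k))))"
proof -
  \<comment> \<open>The two additional factors \<open>k = d - 1\<close> and \<open>k = d\<close> have exponent \<open>0\<close>.\<close>
  have "ee m (CARD('d) - k) = 0" if "\<not> k + 2 \<le> CARD('d)" for k
    unfolding ee_def using that by (intro sum.neutral) auto
  then show ?thesis
    unfolding rr_def char_hom_layer_tensor by (intro prod.mono_neutral_cong_left) auto
qed

lemma zz_eq_char_hom:
  fixes q :: "'n::finite ^ 'd::finite \<Rightarrow> 'k::field"
  shows "zz q l j m = char_hom q (layer_tensor l j (\<lambda>k. int (ff m (CARD('d) - k))))"
proof -
  have "ff m 0 = 0" by (simp add: ff_def)
  then show ?thesis
    unfolding zz_def char_hom_layer_tensor by (intro prod.mono_neutral_cong_left) (auto simp: le_less)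
qed

lemma tpower_eq_layer_tensor:
  assumes "l \<noteq> j"
  shows "(tpower (x *s alpha l + alpha j) :: ('n::finite, 'd::finite) tensor_power) =
    layer_tensor l j (\<lambda>k. x ^ (CARD('d) - k))"
proof -
  have "(tpower (x *s alpha l + alpha j) :: ('n, 'd) tensor_power) $ i =
    layer_tensor l j (\<lambda>k. x ^ (CARD('d) - k)) $ i" for i
  proof (cases "\<forall>\<nu>. i $ \<nu> \<in> {l, j}")
    case True
    have "(tpower (x *s alpha l + alpha j) :: ('n, 'd) tensor_power) $ i =
        (\<Prod>\<nu>\<in>UNIV. if \<nu> \<in> {\<nu>. i $ \<nu> = j} then 1 else x)"
      unfolding tpower_def pure_tensor_def
      using True assms by (auto simp: alpha_def axis_def intro!: prod.cong)
    also have "\<dots> = x ^ card (- {\<nu>. i $ \<nu> = j})"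
      by (subst prod.If_cases) auto
    finally show ?thesis
      using True by (simp add: layer_tensor_def Compl_eq_Diff_UNIV card_Diff_subset)
  next
    case False
    then obtain \<nu> where "i $ \<nu> \<notin> {l, j}" by blast
    then have "\<exists>\<nu>. (x *s alpha l + alpha j) $ (i $ \<nu>) = 0"
      by (intro exI[of _ \<nu>]) (auto simp: alpha_def axis_def)
    then have "(tpower (x *s alpha l + alpha j) :: ('n, 'd) tensor_power) $ i = 0"
      by (simp add: tpower_def pure_tensor_def)
    then show ?thesis
      using False by (auto simp: layer_tensor_def)
  qed
  then show ?thesis by (simp add: vec_eq_iff)
qed

lemma uu_eq_layer_tensor:
  assumes "l \<noteq> j"
  shows "(uu l j m :: ('n::finite, 'd::finite) tensor_power) =
    layer_tensor l j (\<lambda>k. (int m + 1) ^ (CARD('d) - k) - int m ^ (CARD('d) - k))"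
  unfolding uu_def tpower_eq_layer_tensor[OF assms]
  by (auto simp: layer_tensor_def vec_eq_iff)

lemma sigma_uu_eq_layer_tensor:
  assumes "l \<noteq> j" and s: "is_reflection l s" "s (alpha j) = alpha j + int m *s alpha l"
  shows "(tpower_map s (uu l j m) :: ('n::finite, 'd::finite) tensor_power) =
    layer_tensor l j (\<lambda>k. (-1) ^ (CARD('d) - k) - 0 ^ (CARD('d) - k))"
proof -
  have additive: "Modules.additive s" and l: "s (alpha l) = - alpha l"
    using s by (auto simp: is_reflection_def)
  interpret Modules.additive s by (rule additive)
  have "s (x *s alpha l + alpha j) = (int m - x) *s alpha l + alpha j" for x
    by (simp add: s(2) add additive_smult[OF additive] l vec_eq_iff algebra_simps)
  then have "(tpower_map s (uu l j m) :: ('n, 'd) tensor_power) =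
      tpower ((-1) *s alpha l + alpha j) - tpower (0 *s alpha l + alpha j)"
    unfolding uu_def tpower_map_diff tpower_map_tpower[OF additive] by simp
  then show ?thesis
    unfolding tpower_eq_layer_tensor[OF assms(1)] by (auto simp: layer_tensor_def vec_eq_iff)
qed

lemma double_vv_coord:
  fixes i :: "'n::finite ^ 'd::finite"
  assumes "l \<noteq> j" "is_reflection l s" "s (alpha j) = alpha j + int m *s alpha l"
  shows "2 * vv s l j m $ i = (layer_tensor l j (\<lambda>k. (int m + 1) ^ (CARD('d) - k)
    - int m ^ (CARD('d) - k) + ((-1) ^ (CARD('d) - k) - 0 ^ (CARD('d) - k)))) $ i"
proof -
  have "2 * vv s l j m $ i = (tpower_map s (uu l j m) + uu l j m) $ i"
    by (metis vv_double[OF assms(2,3)] vector_smult_component)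
  then show ?thesis
    unfolding vector_add_component vector_minus_component vector_uminus_component
      sigma_uu_eq_layer_tensor[OF assms]
    unfolding uu_eq_layer_tensor[OF assms(1)] by (auto simp: layer_tensor_def)
qed

lemma double_ww_coord:
  fixes i :: "'n::finite ^ 'd::finite"
  assumes "l \<noteq> j" "is_reflection l s" "s (alpha j) = alpha j + int m *s alpha l"
  shows "2 * ww s l j m $ i = (layer_tensor l j (\<lambda>k. (int m + 1) ^ (CARD('d) - k)
    - int m ^ (CARD('d) - k) - ((-1) ^ (CARD('d) - k) - 0 ^ (CARD('d) - k)))) $ i"
proof -
  have "2 * ww s l j m $ i = (- (tpower_map s (uu l j m) - uu l j m)) $ i"
    by (metis ww_double[OF assms(2,3)] vector_smult_component)
  then show ?thesis
    unfolding vector_add_component vector_minus_component vector_uminus_component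
      sigma_uu_eq_layer_tensor[OF assms]
    unfolding uu_eq_layer_tensor[OF assms(1)] by (auto simp: layer_tensor_def)
qed

lemma tensor_eq_doubleI:
  fixes x y :: "int ^ 'i"
  assumes "\<And>i. 2 * x $ i = 2 * y $ i"
  shows "x = y"
  using assms by (simp add: vec_eq_iff)

theorem theorem3p2:
  fixes q :: "'n::finite ^ 'd::finite \<Rightarrow> 'k::field"
    and l j :: 'n
    and \<sigma> :: "nat \<Rightarrow> int ^ 'n \<Rightarrow> int ^ 'n"
  assumes "\<And>i. q i \<noteq> 0"
    and "l \<noteq> j"
    and "\<And>m. is_reflection l (\<sigma> m)"
    and "\<And>m. \<sigma> m (alpha j) = alpha j + int m *s alpha l"
  shows "Rtilde q \<sigma> l j 0 = (1 - rr q l j 0) * (1 - zz q l j 0) \<and>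
    (\<forall>m\<ge>1. Rtilde q \<sigma> l j m =
       rr q l j m * Rtilde q \<sigma> l j (m - 1) + (1 - rr q l j m) * (1 - zz q l j m))"
proof -
  define v w :: "nat \<Rightarrow> ('n, 'd) tensor_power"
    where "v m = vv (\<sigma> m) l j m" and "w m = ww (\<sigma> m) l j m" for m
  define E F :: "nat \<Rightarrow> ('n, 'd) tensor_power"
    where "E m = layer_tensor l j (\<lambda>k. int (ee m (CARD('d) - k)))"
      and "F m = layer_tensor l j (\<lambda>k. int (ff m (CARD('d) - k)))" for m
  note coord = double_vv_coord[where 'd = 'd, OF assms(2-4), folded v_def]
    double_ww_coord[where 'd = 'd, OF assms(2-4), folded w_def]
  have E: "2 * E m $ i = layer_tensor l j (\<lambda>k. (int m + 1) ^ (CARD('d) - k)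
      + (int m - 1) ^ (CARD('d) - k) - 2 * int m ^ (CARD('d) - k)) $ i" for m i
    by (auto simp: E_def layer_tensor_def double_ee)
  have F: "2 * F m $ i = layer_tensor l j (\<lambda>k. (int m + 1) ^ (CARD('d) - k)
      - (int m - 1) ^ (CARD('d) - k)) $ i" for m i
    by (auto simp: F_def layer_tensor_def double_ff)
  have v0: "v 0 = E 0"
    by (rule tensor_eq_doubleI) (simp only: coord E, auto simp: layer_tensor_def)
  have w0: "w 0 = F 0"
    by (rule tensor_eq_doubleI) (simp only: coord F, auto simp: layer_tensor_def)
  have v_Suc: "v (Suc m) = v m + E (Suc m)" for m
    by (rule tensor_eq_doubleI)
      (simp only: vector_add_component distrib_left coord E, auto simp: layer_tensor_def add.commute)
  have w_Suc: "w (Suc m) = w m + E (Suc m)" for m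
    by (rule tensor_eq_doubleI)
      (simp only: vector_add_component distrib_left coord E, auto simp: layer_tensor_def add.commute)
  have F_Suc: "F (Suc m) = v (Suc m) + w m" for m
    by (rule tensor_eq_doubleI)
      (simp only: vector_add_component distrib_left coord F, auto simp: layer_tensor_def add.commute)
  have R: "Rtilde q \<sigma> l j m = (1 - char_hom q (v m)) * (1 - char_hom q (w m))" for m
    by (simp add: Rtilde_def v_def w_def)
  have r: "rr q l j m = char_hom q (E m)" and z: "zz q l j m = char_hom q (F m)" for m
    by (simp_all add: rr_eq_char_hom zz_eq_char_hom E_def F_def)
  note add = char_hom_add[of q, OF assms(1)]
  have "Rtilde q \<sigma> l j (Suc m) = rr q l j (Suc m) * Rtilde q \<sigma> l j m
      + (1 - rr q l j (Suc m)) * (1 - zz q l j (Suc m))" for m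
    unfolding R r z F_Suc w_Suc v_Suc add by (simp add: algebra_simps)
  then have "Rtilde q \<sigma> l j m = rr q l j m * Rtilde q \<sigma> l j (m - 1)
      + (1 - rr q l j m) * (1 - zz q l j m)" if "m \<ge> 1" for m
    using that by (cases m) simp_all
  moreover have "Rtilde q \<sigma> l j 0 = (1 - rr q l j 0) * (1 - zz q l j 0)"
    by (simp add: R r z v0 w0)
  ultimately show ?thesis by blast
qed

end
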